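(* Let $Q_n$ be the para-chain square cactus graph of order $n$. Then: (i) for every $n\geq 1$ and $k\geq 1$, $$ABC_{GG}(Q_n)=8\sum_{i=1}^{k}\sqrt{\frac{6k-1}{(6k-3i+2)(3i-1)}}\quad\text{if } n=2k,$$ $$ABC_{GG}(Q_n)=8\left(\sum_{i=1}^{k}\sqrt{\frac{6k+2}{(6k-3i+5)(3i-1)}}\right)+\frac{4\sqrt{6k+2}}{3k+2}\quad\text{if } n=2k+1;$$ (ii) for every $n\geq 2$, $ABC(Q_n)=2n\sqrt{2}$.
   Context: For a finite simple graph $G$, $ABC(G)=\sum_{uv\in E(G)}\sqrt{\frac{d_u+d_v-2}{d_ud_v}}$, where $d_u$ is the degree of $u$ in $G$. For an edge $uv$ of $G$, $n_u(uv,G)$ is the number of vertices of $G$ strictly closer to $u$ than to $v$, and $n_v(uv,G)$ is defined analogously; equidistant vertices are not counted. $ABC_{GG}(G)=\sum_{uv\in E(G)}\sqrt{\frac{n_u(uv,G)+n_v(uv,G)-2}{n_u(uv,G)n_v(uv,G)}}$. The para-chain square cactus graph $Q_n$ of order $n$ consists of $n$ squares glued in a chain at opposite vertices: take $n$ disjoint 4-cycles, choose in the $i$-th one two opposite vertices $x_i,v_i$ (at distance 2), and identify $v_i$ with $x_{i+1}$ for $i=1,\ldots,n-1$. *)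

theory Defs
  imports Complex_Main "HOL-Library.Extended_Nat"
begin

record 'a sgraph =
  verts :: "'a set"
  edges :: "'a set set"

definition finite_simple_graph :: "'a sgraph \<Rightarrow> bool" where
  "finite_simple_graph G \<longleftrightarrow>
     finite (verts G) \<and> (\<forall>e\<in>edges G. e \<subseteq> verts G \<and> card e = 2)"

definition degree :: "'a sgraph \<Rightarrow> 'a \<Rightarrow> nat" where
  "degree G u = card {v \<in> verts G. {u, v} \<in> edges G}"

definition walk :: "'a sgraph \<Rightarrow> 'a list \<Rightarrow> bool" where
  "walk G p \<longleftrightarrow> p \<noteq> [] \<and> set p \<subseteq> verts G \<and>
     successively (\<lambda>u v. {u, v} \<in> edges G) p"

text \<open>The distance is infinite when there is no connecting walk, since the infimum of the
  empty set of extended naturals is infinity.\<close>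

definition gdist :: "'a sgraph \<Rightarrow> 'a \<Rightarrow> 'a \<Rightarrow> enat" where
  "gdist G u v = (INF p \<in> {p. walk G p \<and> hd p = u \<and> last p = v}. enat (length p - 1))"

definition closer :: "'a sgraph \<Rightarrow> 'a \<Rightarrow> 'a \<Rightarrow> nat" where
  "closer G u v = card {w \<in> verts G. gdist G w u < gdist G w v}"

text \<open>Sum of a symmetric expression in the two end vertices over all edges, each undirected
  edge being counted once.  The description is well defined precisely because the expression is
  symmetric, see the lemma below.\<close>

definition edge_sum :: "'a sgraph \<Rightarrow> ('a \<Rightarrow> 'a \<Rightarrow> real) \<Rightarrow> real" where
  "edge_sum G f = (\<Sum>e\<in>edges G. THE r. \<exists>u v. e = {u, v} \<and> r = f u v)"

lemma edge_value_eq: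
  fixes f :: "'a \<Rightarrow> 'a \<Rightarrow> real"
  assumes "\<And>u v. f u v = f v u"
  shows "(THE r. \<exists>a b. {u, v} = {a, b} \<and> r = f a b) = f u v"
  using assms by (intro the_equality) (auto simp: doubleton_eq_iff)

definition ABC :: "'a sgraph \<Rightarrow> real" where
  "ABC G = edge_sum G (\<lambda>u v.
     sqrt ((real (degree G u) + real (degree G v) - 2) / (real (degree G u) * real (degree G v))))"

definition ABC_GG :: "'a sgraph \<Rightarrow> real" where
  "ABC_GG G = edge_sum G (\<lambda>u v.
     sqrt ((real (closer G u v) + real (closer G v u) - 2) /
           (real (closer G u v) * real (closer G v u))))"

definition quotient_graph :: "'a sgraph \<Rightarrow> ('a \<times> 'a) set \<Rightarrow> 'a set sgraph" where
  "quotient_graph G r =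
     \<lparr> verts = verts G // r, edges = (\<lambda>e. (\<lambda>p. r `` {p}) ` e) ` edges G \<rparr>"

text \<open>Vertex (i, j) is the j-th vertex, in cyclic order, of the i-th 4-cycle; so (i, 0) and
  (i, 2) are opposite.\<close>

definition disjoint_squares :: "nat \<Rightarrow> (nat \<times> nat) sgraph" where
  "disjoint_squares n =
     \<lparr> verts = {1..n} \<times> {..<4},
       edges = {{(i, j), (i, (j + 1) mod 4)} | i j. i \<in> {1..n} \<and> j < 4} \<rparr>"

text \<open>The equivalence relation generated by identifying the vertex (i, 2) of the i-th square with
  the vertex (i + 1, 0) of the next one.\<close>

definition para_glue :: "nat \<Rightarrow> ((nat \<times> nat) \<times> (nat \<times> nat)) set" where
  "para_glue n = (let r = {((i, 2), (i + 1, 0)) | i. 1 \<le> i \<and> i < n} in (r \<union> r\<inverse>)\<^sup>*)"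

definition para_chain :: "nat \<Rightarrow> (nat \<times> nat) set sgraph" where
  "para_chain n = quotient_graph (disjoint_squares n) (para_glue n)"

text \<open>The gluing never identifies two vertices of the same square, so the quotient has no
  loops.\<close>

lemma para_glue_cases:
  assumes "(p, q) \<in> para_glue n"
  shows "p = q \<or> (\<exists>i. p = (i, 2) \<and> q = (i + 1, 0)) \<or> (\<exists>i. p = (i + 1, 0) \<and> q = (i, 2))"
  using assms unfolding para_glue_def Let_def
  by (induction rule: rtrancl_induct) auto

lemma finite_simple_graph_para_chain: "finite_simple_graph (para_chain n)"
proof -
  let ?c = "\<lambda>p. para_glue n `` {p}"
  have "?c (i, j) \<noteq> ?c (i, (j + 1) mod 4)" if "j < 4" for i j :: nat
  proof
    assume eq: "?c (i, j) = ?c (i, (j + 1) mod 4)"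
    have "(i, (j + 1) mod 4) \<in> ?c (i, (j + 1) mod 4)"
      by (simp add: para_glue_def Let_def)
    then have "((i, j), (i, (j + 1) mod 4)) \<in> para_glue n"
      using eq by blast
    then have "j = (j + 1) mod 4"
      using para_glue_cases by fastforce
    then show False
      using that by presburger
  qed
  then have "card {?c (i, j), ?c (i, (j + 1) mod 4)} = 2" if "j < 4" for i j :: nat
    using that by simp
  then show ?thesis
    by (auto simp: finite_simple_graph_def para_chain_def quotient_graph_def disjoint_squares_def
        quotient_def UNION_singleton_eq_range intro!: imageI)
qed

end

theory Submission
  imports Defs
begin

text \<open>Number the vertices of $Q_n$ from left to right by $0, \ldots, 3n$, so that the multiples
  of 3 are the vertices where squares are glued and the two extremes of the chain (all of them
  called cut vertices below), and the two middle vertices of a square are the two numbers between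
  its cut vertices.  Place vertex $m$ on level $\lfloor (2m+1)/3 \rfloor$; then the levels have
  alternately one and two vertices, and two vertices are adjacent exactly when their levels
  differ by one (\<open>level_graph\<close>).  That the glued squares are isomorphic to this graph is
  \<open>para_chain_level_graph\<close>: the equivalence classes of the gluing are the fibres of the
  numbering, and every quantity involved is invariant under isomorphism.

  In the level graph, distance is the difference of levels, except that the two vertices of a
  middle level have distance 2 (\<open>gdist_level_graph\<close>).  Hence, from the lower end $x$ of an edge
  in the $i$-th square (counting from 0), the vertices nearer to $x$ than to the upper end are the
  $3i+1$ vertices up to the left cut vertex of the square and one of its two middle vertices.
  That makes $3i+2$.  No vertex is equidistant, because the graph is bipartite, so the other
  $3n-3i-1$ vertices are nearer to the upper end (\<open>closer_ends\<close>).  All four edges of a square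
  therefore contribute the same term to $ABC_{GG}$.  Reflecting the chain exchanges the terms of
  the squares $i$ and $n-1-i$, so the sum folds in half, leaving the middle square alone when $n$
  is odd.

  For $ABC$, every edge has a middle vertex as an end, and that vertex has degree 2.  As
  $(2+d-2)/(2d) = 1/2$ for every $d > 0$, each of the $4n$ edges contributes
  $\sqrt{1/2}$, whatever the degree of its other end.\<close>

section \<open>Images of graphs\<close>

definition graph_image :: "('a \<Rightarrow> 'b) \<Rightarrow> 'a sgraph \<Rightarrow> 'b sgraph" where
  "graph_image h G = \<lparr> verts = h ` verts G, edges = (`) h ` edges G \<rparr>"

text \<open>A quotient is hard to compute in, because its vertices are sets.  If the classes are the
  fibres of a map \<open>\<phi>\<close>, it can be traded for the image under \<open>\<phi>\<close>: the class of \<open>p\<close> is the fibre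
  over \<open>\<phi> p\<close>, so the quotient map factors through \<open>\<phi>\<close>, and the second factor is injective
  (\<open>inj_on_fibres\<close>).\<close>

lemma quotient_graph_eq_image_of_fibres:
  assumes sub: "\<Union> (edges G) \<subseteq> verts G"
    and cls: "\<And>p. p \<in> verts G \<Longrightarrow> r `` {p} = {q \<in> verts G. \<phi> q = \<phi> p}"
  shows "quotient_graph G r = graph_image (\<lambda>m. {q \<in> verts G. \<phi> q = m}) (graph_image \<phi> G)"
proof -
  have "verts G // r = (\<lambda>m. {q \<in> verts G. \<phi> q = m}) ` \<phi> ` verts G"
    by (auto simp: quotient_def cls)
  moreover have "(\<lambda>p. r `` {p}) ` e = (\<lambda>m. {q \<in> verts G. \<phi> q = m}) ` \<phi> ` e" if "e \<in> edges G" for e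
    unfolding image_image using sub that cls by (intro image_cong) auto
  ultimately show ?thesis
    by (simp add: quotient_graph_def graph_image_def image_image cong: image_cong)
qed

lemma inj_on_fibres: "inj_on (\<lambda>m. {q \<in> V. \<phi> q = m}) (\<phi> ` V)"
  by (rule inj_onI) auto

text \<open>An injective map is an isomorphism onto its image, so it preserves degrees, walks,
  distances and the counts of nearer vertices.\<close>

locale graph_embedding =
  fixes h :: "'a \<Rightarrow> 'b" and G :: "'a sgraph"
  assumes inj: "inj_on h (verts G)"
    and sub: "\<Union> (edges G) \<subseteq> verts G"
begin

lemma edge_image_iff:
  assumes "u \<in> verts G" "v \<in> verts G"
  shows "{h u, h v} \<in> edges (graph_image h G) \<longleftrightarrow> {u, v} \<in> edges G"
proof
  assume "{h u, h v} \<in> edges (graph_image h G)"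
  then obtain e where e: "e \<in> edges G" "h ` {u, v} = h ` e"
    by (auto simp: graph_image_def)
  then have "{u, v} = e"
    using inj_on_image_eq_iff[OF inj, of "{u, v}" e] assms sub by auto
  with e show "{u, v} \<in> edges G" by simp
next
  assume "{u, v} \<in> edges G"
  then have "h ` {u, v} \<in> (`) h ` edges G"
    by (rule imageI)
  then show "{h u, h v} \<in> edges (graph_image h G)"
    by (simp add: graph_image_def)
qed

lemma degree_image:
  assumes "u \<in> verts G"
  shows "degree (graph_image h G) (h u) = degree G u"
proof -
  have "{v \<in> verts (graph_image h G). {h u, v} \<in> edges (graph_image h G)}
      = h ` {v \<in> verts G. {u, v} \<in> edges G}"
    using edge_image_iff[OF assms] by (auto simp: graph_image_def)
  moreover have "inj_on h {v \<in> verts G. {u, v} \<in> edges G}"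
    using inj by (rule inj_on_subset) auto
  ultimately show ?thesis
    by (simp add: degree_def card_image)
qed

lemma walk_image_iff:
  assumes "set p \<subseteq> verts G"
  shows "walk (graph_image h G) (map h p) \<longleftrightarrow> walk G p"
proof -
  have "{h u, h v} \<in> edges (graph_image h G) \<longleftrightarrow> {u, v} \<in> edges G"
    if "u \<in> set p" "v \<in> set p" for u v
    using that assms edge_image_iff by blast
  then have A: "successively (\<lambda>u v. {h u, h v} \<in> edges (graph_image h G)) p
      \<longleftrightarrow> successively (\<lambda>u v. {u, v} \<in> edges G) p"
    by (rule successively_cong[OF _ refl])
  have "h ` set p \<subseteq> verts (graph_image h G)"
    using assms by (auto simp: graph_image_def)
  then show ?thesis
    using assms by (simp add: walk_def successively_map A)
qed

lemma gdist_image: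
  assumes "u \<in> verts G" "v \<in> verts G"
  shows "gdist (graph_image h G) (h u) (h v) = gdist G u v"
proof -
  let ?W = "{p. walk G p \<and> hd p = u \<and> last p = v}"
  have "{p. walk (graph_image h G) p \<and> hd p = h u \<and> last p = h v} = map h ` ?W"
  proof (intro set_eqI iffI)
    fix p assume "p \<in> {p. walk (graph_image h G) p \<and> hd p = h u \<and> last p = h v}"
    then have p: "walk (graph_image h G) p" "hd p = h u" "last p = h v" "p \<noteq> []"
      by (auto simp: walk_def)
    \<comment> \<open>A walk in the image visits only images of vertices, so it can be lifted.\<close>
    have "p \<in> map h ` lists (verts G)"
      using p(1) unfolding lists_image[symmetric] by (simp add: walk_def graph_image_def lists_eq_set)
    then obtain q where q: "set q \<subseteq> verts G" "p = map h q"
      by (auto simp: lists_eq_set)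
    then have "q \<noteq> []" using p by auto
    then have "hd q \<in> verts G" "last q \<in> verts G" using q by auto
    moreover have "h (hd q) = h u" "h (last q) = h v"
      using p q \<open>q \<noteq> []\<close> by (auto simp: hd_map last_map)
    ultimately have "hd q = u" "last q = v"
      using inj assms by (auto dest: inj_onD)
    moreover have "walk G q" using p(1) q walk_image_iff by simp
    ultimately show "p \<in> map h ` ?W" using q by blast
  next
    fix p assume "p \<in> map h ` ?W"
    then obtain q where q: "p = map h q" "walk G q" "hd q = u" "last q = v" by auto
    then have "q \<noteq> []" "set q \<subseteq> verts G" by (auto simp: walk_def)
    then show "p \<in> {p. walk (graph_image h G) p \<and> hd p = h u \<and> last p = h v}"
      using q walk_image_iff[of q] by (auto simp: hd_map last_map)
  qed
  then show ?thesis by (simp add: gdist_def image_image)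
qed

lemma closer_image:
  assumes "u \<in> verts G" "v \<in> verts G"
  shows "closer (graph_image h G) (h u) (h v) = closer G u v"
proof -
  have "{w \<in> verts (graph_image h G).
          gdist (graph_image h G) w (h u) < gdist (graph_image h G) w (h v)}
      = h ` {w \<in> verts G. gdist G w u < gdist G w v}"
    using assms by (auto simp: graph_image_def[of h G, THEN arg_cong, of verts] gdist_image)
  moreover have "inj_on h {w \<in> verts G. gdist G w u < gdist G w v}"
    using inj by (rule inj_on_subset) auto
  ultimately show ?thesis
    by (simp add: closer_def card_image)
qed

end

text \<open>Parametrising the edges by ordered pairs of ends removes the choice of an orientation
  from \<open>edge_sum\<close>.\<close>

lemma edge_sum_parametrised:
  assumes edg: "edges G = (\<lambda>p. {a p, b p}) ` I"
    and inj: "inj_on (\<lambda>p. {a p, b p}) I"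
    and sym: "\<And>u v. f u v = f v u"
  shows "edge_sum G f = (\<Sum>p\<in>I. f (a p) (b p))"
  unfolding edge_sum_def edg sum.reindex[OF inj] comp_def
  using edge_value_eq[of f, OF sym] by simp

section \<open>Certifying distances\<close>

text \<open>A function \<open>d\<close> with \<open>d u = 0\<close> that changes by at most one along an edge is a lower bound for
  the distance to \<open>u\<close>, since each step of a walk ending in \<open>u\<close> can account for at most one.  If
  in addition every other vertex has a neighbour where \<open>d\<close> is smaller by one, then descending
  along such neighbours gives a walk that attains the bound.\<close>

lemma gdist_eqI:
  fixes d :: "'a \<Rightarrow> nat"
  assumes start: "d u = 0"
    and lipschitz: "\<And>x y. x \<in> verts G \<Longrightarrow> y \<in> verts G \<Longrightarrow> {x, y} \<in> edges G \<Longrightarrow> d x \<le> Suc (d y)"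
    and descent: "\<And>x. x \<in> verts G \<Longrightarrow> x \<noteq> u \<Longrightarrow>
                    \<exists>y\<in>verts G. {x, y} \<in> edges G \<and> d x = Suc (d y)"
    and w: "w \<in> verts G"
  shows "gdist G w u = enat (d w)"
proof (rule antisym)
  have "\<exists>p. walk G p \<and> hd p = w \<and> last p = u \<and> length p = Suc (d w)"
    using w
  proof (induction "d w" arbitrary: w)
    case 0
    then have "w = u" using descent by fastforce
    then show ?case using 0 by (intro exI[of _ "[w]"]) (auto simp: walk_def)
  next
    case (Suc k)
    then have "w \<noteq> u" using start by auto
    then obtain y where y: "y \<in> verts G" "{w, y} \<in> edges G" "d w = Suc (d y)"
      using descent Suc.prems by blast
    then obtain p where p: "walk G p" "hd p = y" "last p = u" "length p = Suc (d y)"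
      using Suc.hyps by auto
    then show ?case
      using y Suc.prems by (intro exI[of _ "w # p"]) (auto simp: walk_def successively_Cons)
  qed
  then obtain p where "walk G p" "hd p = w" "last p = u" "length p - 1 = d w" by auto
  then show "gdist G w u \<le> enat (d w)"
    unfolding gdist_def by (intro INF_lower2[of p]) auto
next
  have "d (hd p) \<le> length p - 1" if "walk G p" "last p = u" for p
    using that
  proof (induction p)
    case (Cons x p)
    show ?case
    proof (cases p)
      case Nil
      then show ?thesis using Cons.prems start by simp
    next
      case (Cons y q)
      then have "d y \<le> length q" "d x \<le> Suc (d y)"
        using Cons.IH Cons.prems lipschitz[of x y] by (auto simp: walk_def)
      then show ?thesis using Cons by simp
    qed
  qed (simp add: walk_def)
  then show "enat (d w) \<le> gdist G w u"
    unfolding gdist_def by (intro INF_greatest) auto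
qed

section \<open>The chain of squares in levels\<close>

text \<open>The levels of $3i$, $3i+1$, $3i+2$ and $3i+3$ are $2i$, $2i+1$, $2i+1$ and $2i+2$.\<close>

definition level :: "nat \<Rightarrow> nat" where
  "level m = (2 * m + 1) div 3"

definition level_graph :: "nat \<Rightarrow> nat sgraph" where
  "level_graph n = \<lparr> verts = {..3 * n},
     edges = {{x, y} | x y. y \<le> 3 * n \<and> level y = Suc (level x)} \<rparr>"

lemma level_bounds: "3 * level m \<le> 2 * m + 1" "2 * m + 1 < 3 * level m + 3"
  unfolding level_def by linarith+

lemma level_eq_even_iff: "level m = 2 * i \<longleftrightarrow> m = 3 * i"
  and level_eq_odd_iff: "level m = 2 * i + 1 \<longleftrightarrow> m = 3 * i + 1 \<or> m = 3 * i + 2"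
  and level_less_even_iff: "level m < 2 * i \<longleftrightarrow> m < 3 * i"
  and level_less_odd_iff: "level m < 2 * i + 1 \<longleftrightarrow> m \<le> 3 * i"
  using level_bounds[of m] by arith+

lemma level_simps [simp]:
  "level 0 = 0" "level (3 * i) = 2 * i" "level (3 * i + 1) = 2 * i + 1" "level (Suc (3 * i)) = 2 * i + 1"
  "level (3 * i + 2) = 2 * i + 1" "level (Suc (Suc (3 * i))) = 2 * i + 1"
  "level (3 * i + 3) = 2 * i + 2"
  by (simp_all add: level_def)

lemma mod_3_cases:
  fixes m :: nat
  obtains i where "m = 3 * i" | i where "m = 3 * i + 1" | i where "m = 3 * i + 2"
proof -
  have "m = 3 * (m div 3) \<or> m = 3 * (m div 3) + 1 \<or> m = 3 * (m div 3) + 2"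
    by linarith
  then show ?thesis using that by blast
qed

lemma less_if_level_less: "level x < level y \<Longrightarrow> x < y"
  using level_bounds[of x] level_bounds[of y] by linarith

lemma verts_level_graph [simp]: "verts (level_graph n) = {..3 * n}"
  by (simp add: level_graph_def)

lemma edge_level_graph_iff [simp]:
  "{x, y} \<in> edges (level_graph n) \<longleftrightarrow>
     x \<le> 3 * n \<and> y \<le> 3 * n \<and> (level y = Suc (level x) \<or> level x = Suc (level y))"
  using less_if_level_less[of x y] less_if_level_less[of y x]
  by (auto simp: level_graph_def doubleton_eq_iff)

lemma sub_level_graph: "\<Union> (edges (level_graph n)) \<subseteq> verts (level_graph n)"
proof -
  have "x \<le> 3 * n" if "y \<le> 3 * n" "level y = Suc (level x)" for x y
    using that less_if_level_less[of x y] by simp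
  then show ?thesis by (auto simp: level_graph_def)
qed

text \<open>The pair \<open>(i, j)\<close> stands for the \<open>j\<close>-th of the four edges between $3i$ and $3i+3$: the edges
  0 and 1 leave the left cut vertex $3i$, the edges 2 and 3 enter the right one.\<close>

definition lower_end :: "nat \<times> nat \<Rightarrow> nat" where
  "lower_end p = (case p of (i, j) \<Rightarrow> 3 * i + (if j < 2 then 0 else j - 1))"

definition upper_end :: "nat \<times> nat \<Rightarrow> nat" where
  "upper_end p = (case p of (i, j) \<Rightarrow> 3 * i + (if j < 2 then j + 1 else 3))"

lemma level_suc_cases:
  assumes "level y = Suc (level x)"
  obtains i j where "j < 4" "x = lower_end (i, j)" "y = upper_end (i, j)"
proof -
  obtain i where "x = 3 * i \<or> x = 3 * i + 1 \<or> x = 3 * i + 2"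
    by (rule mod_3_cases[of x]) auto
  then have "x = 3 * i \<and> (y = 3 * i + 1 \<or> y = 3 * i + 2) \<or> (x = 3 * i + 1 \<or> x = 3 * i + 2) \<and> y = 3 * i + 3"
    using assms level_eq_odd_iff[of y i] level_eq_even_iff[of y "i + 1"] by auto
  then consider "x = 3 * i" "y = 3 * i + 1" | "x = 3 * i" "y = 3 * i + 2"
    | "x = 3 * i + 1" "y = 3 * i + 3" | "x = 3 * i + 2" "y = 3 * i + 3"
    by auto
  then show ?thesis
    using that[of 0 i] that[of 1 i] that[of 2 i] that[of 3 i]
    by cases (auto simp: lower_end_def upper_end_def)
qed

lemma less_four_iff: "(j::nat) < 4 \<longleftrightarrow> j = 0 \<or> j = 1 \<or> j = 2 \<or> j = 3"
  by auto

lemma level_ends: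
  "j < 4 \<Longrightarrow> level (upper_end (i, j)) = Suc (level (lower_end (i, j)))"
  unfolding lower_end_def upper_end_def less_four_iff by auto

lemma edges_level_graph:
  "edges (level_graph n) = (\<lambda>p. {lower_end p, upper_end p}) ` ({..<n} \<times> {..<4})"
proof (intro set_eqI iffI)
  fix e assume "e \<in> edges (level_graph n)"
  then obtain x y where e: "e = {x, y}" "y \<le> 3 * n" "level y = Suc (level x)"
    by (auto simp: level_graph_def)
  then obtain i j where "j < 4" "x = lower_end (i, j)" "y = upper_end (i, j)"
    using level_suc_cases by blast
  moreover from this e have "i < n"
    by (auto simp: upper_end_def split: if_splits)
  ultimately show "e \<in> (\<lambda>p. {lower_end p, upper_end p}) ` ({..<n} \<times> {..<4})"
    using e by auto
next
  fix e assume "e \<in> (\<lambda>p. {lower_end p, upper_end p}) ` ({..<n} \<times> {..<4})"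
  then obtain i j where e: "i < n" "j < 4" "e = {lower_end (i, j), upper_end (i, j)}"
    by auto
  moreover from this have "upper_end (i, j) \<le> 3 * n"
    by (auto simp: upper_end_def)
  ultimately show "e \<in> edges (level_graph n)"
    using level_ends[of j i] unfolding level_graph_def by auto
qed

lemma inj_on_ends: "inj_on (\<lambda>p. {lower_end p, upper_end p}) ({..<n} \<times> {..<4})"
proof (rule inj_onI)
  fix p q
  assume mem: "p \<in> {..<n} \<times> {..<4::nat}" "q \<in> {..<n} \<times> {..<4::nat}"
    and eq: "{lower_end p, upper_end p} = {lower_end q, upper_end q}"
  obtain i j i' j' where pq: "p = (i, j)" "q = (i', j')" by (cases p, cases q)
  with mem have j: "j < 4" "j' < 4" by auto
  then have "level (lower_end p) < level (upper_end p)" "level (lower_end q) < level (upper_end q)"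
    unfolding pq by (simp_all add: level_ends)
  then have "lower_end p < upper_end p" "lower_end q < upper_end q"
    by (simp_all add: less_if_level_less)
  then have "lower_end p = lower_end q" "upper_end p = upper_end q"
    using eq by (auto simp: doubleton_eq_iff)
  \<comment> \<open>The lower end determines the square, since it is never the right cut vertex.\<close>
  moreover have "lower_end (i, j) div 3 = i" "lower_end (i', j') div 3 = i'"
    using j by (auto simp: lower_end_def)
  ultimately have "i = i'" by (metis pq)
  with \<open>lower_end p = _\<close> \<open>upper_end p = _\<close> show "p = q"
    using j unfolding pq lower_end_def upper_end_def less_four_iff by auto
qed

section \<open>The para-chain is a level graph\<close>

text \<open>Going around the square \<open>i\<close> (counted from 1) meets the numbers $3i-3$, $3i-2$, $3i$ and
  $3i-1$, which explains the exchange of 2 and 3.  The right cut vertex of a square and the left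
  cut vertex of the next one get the same number.\<close>

definition numbering :: "nat \<times> nat \<Rightarrow> nat" where
  "numbering p = (case p of (i, j) \<Rightarrow>
     3 * (i - 1) + (if j = 2 then 3 else if j = 3 then 2 else j))"

lemma numbering_verts:
  assumes "n \<ge> 1"
  shows "numbering ` verts (disjoint_squares n) = {..3 * n}"
proof (intro set_eqI iffI)
  fix m assume "m \<in> numbering ` verts (disjoint_squares n)"
  then show "m \<in> {..3 * n}"
    by (auto simp: disjoint_squares_def numbering_def)
next
  fix m assume m: "m \<in> {..3 * n}"
  have V: "verts (disjoint_squares n) = {1..n} \<times> {..<4}"
    by (simp add: disjoint_squares_def)
  show "m \<in> numbering ` verts (disjoint_squares n)"
  proof (cases "m = 3 * n")
    case True
    then have "m = numbering (n, 2)" using assms by (simp add: numbering_def)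
    then show ?thesis using assms by (auto simp: V)
  next
    case False
    define i j where "i = m div 3" and "j = m mod 3"
    have ij: "m = 3 * i + j" "j < 3" by (simp_all add: i_def j_def)
    then have "m = numbering (Suc i, if j = 2 then 3 else j)"
      by (simp add: numbering_def)
    moreover have "(Suc i, if j = 2 then 3 else j) \<in> verts (disjoint_squares n)"
      using False m ij by (simp add: V)
    ultimately show ?thesis by (rule image_eqI)
  qed
qed

lemma numbering_edges:
  "(`) numbering ` edges (disjoint_squares n) = edges (level_graph n)"
proof -
  \<comment> \<open>The edge from the j-th vertex of a square to the next one in cyclic order is the edge s j in the
    order by levels.\<close>
  define s :: "nat \<Rightarrow> nat"
    where "s j = (if j = 1 then 2 else if j = 2 then 3 else if j = 3 then 1 else 0)" for j
  have step: "numbering ` {(Suc i, j), (Suc i, (j + 1) mod 4)}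
      = {lower_end (i, s j), upper_end (i, s j)}" if "j < 4" for i j
    using that unfolding less_four_iff
    by (elim disjE)
      (simp_all add: numbering_def lower_end_def upper_end_def s_def insert_commute)
  have "{..<4} = {0, 1, 2, 3::nat}" by auto
  then have s: "s ` {..<4} = {..<4}"
    by (simp add: s_def insert_commute)
  have coll: "{F i j | i j. i \<in> A \<and> j < m} = (\<lambda>(i, j). F i j) ` (A \<times> {..<m})"
    for F :: "nat \<Rightarrow> nat \<Rightarrow> (nat \<times> nat) set" and A and m :: nat
    by auto
  have "edges (disjoint_squares n) = (\<lambda>(i, j). {(i, j), (i, (j + 1) mod 4)}) ` ({1..n} \<times> {..<4})"
    unfolding disjoint_squares_def sgraph.select_convs
    by (rule coll[of "\<lambda>i j. {(i, j), (i, (j + 1) mod 4)}"])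
  also have "{1..n} \<times> {..<4} = map_prod Suc id ` ({..<n} \<times> {..<4::nat})"
    by (rule sym, rule map_prod_surj_on) (simp_all add: image_Suc_lessThan)
  finally have "(`) numbering ` edges (disjoint_squares n)
      = (\<lambda>(i, j). numbering ` {(Suc i, j), (Suc i, (j + 1) mod 4)}) ` ({..<n} \<times> {..<4})"
    by (simp add: image_image case_prod_unfold map_prod_def)
  also have "\<dots> = (\<lambda>(i, j). {lower_end (i, s j), upper_end (i, s j)}) ` ({..<n} \<times> {..<4})"
    by (rule image_cong) (use step in \<open>simp_all only: mem_Times_iff lessThan_iff case_prod_unfold\<close>)
  also have "\<dots> = (\<lambda>p. {lower_end p, upper_end p}) ` map_prod id s ` ({..<n} \<times> {..<4})"
    by (simp add: image_image case_prod_unfold map_prod_def)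
  also have "map_prod id s ` ({..<n} \<times> {..<4}) = {..<n} \<times> {..<4}"
    by (rule map_prod_surj_on) (simp_all add: s)
  finally show ?thesis
    by (simp only: edges_level_graph)
qed

lemma numbering_image:
  assumes "n \<ge> 1"
  shows "graph_image numbering (disjoint_squares n) = level_graph n"
  unfolding graph_image_def numbering_verts[OF assms] numbering_edges
  by (simp add: level_graph_def)

text \<open>Along a chain of identifications the number is constant.  Conversely, two different
  vertices with the same number are directly identified, since only cut vertices share a number,
  and no more than two squares meet in one.\<close>

lemma para_glue_class:
  assumes "p \<in> verts (disjoint_squares n)"
  shows "para_glue n `` {p} = {q \<in> verts (disjoint_squares n). numbering q = numbering p}"
proof (intro set_eqI iffI)
  fix q assume "q \<in> para_glue n `` {p}"
  then have "(p, q) \<in> para_glue n" by simp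
  then have "q \<in> verts (disjoint_squares n) \<and> numbering q = numbering p"
    unfolding para_glue_def Let_def
  proof (induction rule: rtrancl_induct)
    case base
    then show ?case using assms by simp
  next
    case (step q q')
    then show ?case by (auto simp: disjoint_squares_def numbering_def)
  qed
  then show "q \<in> {q \<in> verts (disjoint_squares n). numbering q = numbering p}" by simp
next
  fix q assume "q \<in> {q \<in> verts (disjoint_squares n). numbering q = numbering p}"
  moreover obtain i j i' j' where pq: "p = (i, j)" "q = (i', j')" by fastforce
  ultimately have b: "1 \<le> i" "i \<le> n" "1 \<le> i'" "i' \<le> n" "j < 4" "j' < 4"
    and eq: "numbering (i', j') = numbering (i, j)"
    using assms by (auto simp: disjoint_squares_def)
  have "i = i' \<and> j = j' \<or> i' = i + 1 \<and> j = 2 \<and> j' = 0 \<or> i = i' + 1 \<and> j = 0 \<and> j' = 2"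
    using b(1,3) eq b(5,6) unfolding numbering_def less_four_iff
    by (elim disjE; simp; arith)
  then show "q \<in> para_glue n `` {p}"
    using b unfolding pq para_glue_def Let_def by (elim disjE) (auto intro: r_into_rtrancl)
qed

lemma para_chain_level_graph:
  assumes "n \<ge> 1"
  obtains h where "graph_embedding h (level_graph n)"
    "para_chain n = graph_image h (level_graph n)"
proof
  let ?V = "verts (disjoint_squares n)"
  let ?h = "\<lambda>m. {q \<in> ?V. numbering q = m}"
  have img: "graph_image numbering (disjoint_squares n) = level_graph n"
    using assms by (rule numbering_image)
  then have "numbering ` ?V = verts (level_graph n)"
    by (metis graph_image_def sgraph.select_convs(1))
  then show "graph_embedding ?h (level_graph n)"
    using inj_on_fibres[of ?V numbering] sub_level_graph by (simp add: graph_embedding_def)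
  have "\<Union> (edges (disjoint_squares n)) \<subseteq> ?V"
    by (auto simp: disjoint_squares_def)
  from quotient_graph_eq_image_of_fibres[OF this para_glue_class]
  show "para_chain n = graph_image ?h (level_graph n)"
    unfolding para_chain_def img by simp
qed

section \<open>Sums over the edges of the chain\<close>

lemma edge_sum_para_chain:
  assumes emb: "graph_embedding h (level_graph n)"
    and sym: "\<And>u v. f u v = f v u"
  shows "edge_sum (graph_image h (level_graph n)) f
    = (\<Sum>(i, j)\<in>{..<n} \<times> {..<4}. f (h (lower_end (i, j))) (h (upper_end (i, j))))"
proof -
  interpret graph_embedding h "level_graph n" by (rule emb)
  have "edges (graph_image h (level_graph n))
      = (`) h ` (\<lambda>p. {lower_end p, upper_end p}) ` ({..<n} \<times> {..<4})"
    by (simp add: graph_image_def edges_level_graph)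
  also have "\<dots> = (\<lambda>p. {h (lower_end p), h (upper_end p)}) ` ({..<n} \<times> {..<4})"
    by (simp add: image_image)
  finally have edg: "edges (graph_image h (level_graph n)) = \<dots>" .
  have "inj_on ((`) h) (edges (level_graph n))"
    using inj_on_image[OF inj_on_subset[OF inj sub]] .
  from comp_inj_on[OF inj_on_ends this[unfolded edges_level_graph]]
  have "inj_on (\<lambda>p. {h (lower_end p), h (upper_end p)}) ({..<n} \<times> {..<4})"
    by (simp add: comp_def)
  from edge_sum_parametrised[OF edg this sym] show ?thesis
    by (simp add: case_prod_unfold)
qed

lemma ends_le: "i < n \<Longrightarrow> j < 4 \<Longrightarrow> lower_end (i, j) \<le> 3 * n \<and> upper_end (i, j) \<le> 3 * n"
  by (auto simp: lower_end_def upper_end_def)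

text \<open>The two vertices of a middle level are adjacent only to the cut vertices of their square.\<close>

lemma degree_level_graph_eq_2:
  assumes "i < n" "m = 3 * i + 1 \<or> m = 3 * i + 2"
  shows "degree (level_graph n) m = 2"
proof -
  have m: "level m = 2 * i + 1" "m \<le> 3 * n"
    using assms by auto
  have "{m, v} \<in> edges (level_graph n) \<longleftrightarrow> v = 3 * i \<or> v = 3 * i + 3" if "v \<le> 3 * n" for v
  proof -
    have "{m, v} \<in> edges (level_graph n) \<longleftrightarrow> level v = 2 * i \<or> level v = 2 * (i + 1)"
      unfolding edge_level_graph_iff m(1) using that m(2) by auto
    also have "\<dots> \<longleftrightarrow> v = 3 * i \<or> v = 3 * i + 3"
      unfolding level_eq_even_iff by (simp add: add.commute)
    finally show ?thesis .
  qed
  then have "{v \<in> verts (level_graph n). {m, v} \<in> edges (level_graph n)} = {3 * i, 3 * i + 3}"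
    using assms(1) by (auto simp del: edge_level_graph_iff)
  then show ?thesis by (simp add: degree_def)
qed

lemma degree_pos:
  assumes "finite (verts G)" "v \<in> verts G" "{u, v} \<in> edges G"
  shows "degree G u > 0"
  using assms by (auto simp: degree_def card_gt_0_iff)

lemma ABC_para_chain:
  assumes "n \<ge> 1"
  shows "ABC (para_chain n) = 2 * real n * sqrt 2"
proof -
  obtain h where emb: "graph_embedding h (level_graph n)"
    and pc: "para_chain n = graph_image h (level_graph n)"
    using para_chain_level_graph[OF assms] .
  interpret graph_embedding h "level_graph n" by (rule emb)
  let ?f = "\<lambda>a b. sqrt ((real a + real b - 2) / (real a * real b))"
  have val: "?f (degree (para_chain n) (h (lower_end (i, j))))
                (degree (para_chain n) (h (upper_end (i, j)))) = sqrt 2 / 2"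
    if "i < n" "j < 4" for i j
  proof -
    define a b where "a = degree (level_graph n) (lower_end (i, j))"
      and "b = degree (level_graph n) (upper_end (i, j))"
    \<comment> \<open>One end has degree 2, and then the degree of the other end cancels, provided that it is not 0.\<close>
    have edge: "{lower_end (i, j), upper_end (i, j)} \<in> edges (level_graph n)"
      using ends_le[OF that] level_ends[OF that(2)] by simp
    then have "a > 0" "b > 0"
      unfolding a_def b_def using ends_le[OF that]
      by (auto intro!: degree_pos[OF _ _ edge] degree_pos[OF _ _ edge[unfolded insert_commute[of _ "upper_end _"]]]
          simp del: edge_level_graph_iff)
    moreover have "a = 2 \<or> b = 2"
      unfolding a_def b_def using that(2) degree_level_graph_eq_2[OF that(1)]
      unfolding less_four_iff by (elim disjE) (simp_all add: lower_end_def upper_end_def)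
    ultimately have "(real a + real b - 2) / (real a * real b) = 1 / 2"
      by (elim disjE) (simp_all add: field_simps)
    then have "?f a b = sqrt (1 / 2)"
      by (rule arg_cong)
    also have "\<dots> = sqrt 2 / 2"
      by (simp add: real_sqrt_divide field_simps)
    finally show ?thesis
      using ends_le[OF that] by (simp add: pc degree_image a_def b_def)
  qed
  have "ABC (para_chain n) = (\<Sum>(i, j)\<in>{..<n} \<times> {..<4::nat}. sqrt 2 / 2)"
    unfolding ABC_def pc
  proof (subst edge_sum_para_chain[OF emb])
    show "?f (degree (graph_image h (level_graph n)) u) (degree (graph_image h (level_graph n)) v)
        = ?f (degree (graph_image h (level_graph n)) v) (degree (graph_image h (level_graph n)) u)" for u v
      by (simp only: add.commute mult.commute)
  qed (rule sum.cong[OF refl], use val[unfolded pc] in auto)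
  then show ?thesis by simp
qed

section \<open>Distances in the level graph\<close>

definition level_dist :: "nat \<Rightarrow> nat \<Rightarrow> nat" where
  "level_dist x y = (if x \<noteq> y \<and> level x = level y then 2
     else nat \<bar>int (level x) - int (level y)\<bar>)"

text \<open>Every vertex below the top level has neighbours one level up, and every vertex above
  level 0 has neighbours one level down, so levels can be climbed one by one.  Two distinct
  vertices on the same level are the middle vertices of a square and have a common neighbour.\<close>

lemma gdist_level_graph:
  assumes "w \<le> 3 * n" "u \<le> 3 * n"
  shows "gdist (level_graph n) w u = enat (level_dist w u)"
proof (rule gdist_eqI)
  show "level_dist u u = 0" by (simp add: level_dist_def)
next
  fix x y assume "{x, y} \<in> edges (level_graph n)"
  then show "level_dist x u \<le> Suc (level_dist y u)"
    by (auto simp: level_dist_def)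
next
  fix x assume x: "x \<in> verts (level_graph n)" "x \<noteq> u"
  have up: "\<exists>y\<le>3 * n. level y = Suc (level x)" if "level x < level u"
  proof (cases rule: mod_3_cases[of x])
    case (1 i)
    then show ?thesis using less_if_level_less[OF that] assms(2)
      by (intro exI[of _ "3 * i + 1"]) auto
  next
    case (2 i)
    then have "i < n" using less_if_level_less[OF that] assms(2) by linarith
    with 2 show ?thesis
      by (intro exI[of _ "3 * i + 3"]) auto
  next
    case (3 i)
    then show ?thesis using less_if_level_less[OF that] assms(2)
      by (intro exI[of _ "3 * i + 3"]) auto
  qed
  have down: "\<exists>y\<le>3 * n. level x = Suc (level y)" if pos: "0 < level x"
  proof (cases rule: mod_3_cases[of x])
    case (1 i)
    then obtain k where "i = Suc k" using pos by (cases i) auto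
    then show ?thesis using 1 x level_simps(7)[of k]
      by (intro exI[of _ "3 * k + 2"]) (auto simp: add.commute)
  next
    case (2 i)
    then show ?thesis using x by (intro exI[of _ "3 * i"]) auto
  next
    case (3 i)
    then show ?thesis using x by (intro exI[of _ "3 * i"]) auto
  qed
  \<comment> \<open>Level 0 has a single vertex, so there is room to step down from a vertex that shares its
    level with another one.\<close>
  have zero: "level x = 0 \<longleftrightarrow> x = 0" for x
    using level_eq_even_iff[of x 0] by simp
  consider "level x = Suc (level u) \<or> level u = Suc (level x)" | "level x = level u"
    | "Suc (level u) < level x" | "Suc (level x) < level u" by linarith
  then show "\<exists>y\<in>verts (level_graph n). {x, y} \<in> edges (level_graph n)
      \<and> level_dist x u = Suc (level_dist y u)"
  proof cases
    case 1
    then show ?thesis using x assms by (intro bexI[of _ u]) (auto simp: level_dist_def)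
  next
    case 2
    then have "0 < level x" using x zero[of x] zero[of u] by (cases "level x") auto
    then obtain y where "y \<le> 3 * n" "level x = Suc (level y)" using down by auto
    then show ?thesis using 2 x by (intro bexI[of _ y]) (auto simp: level_dist_def)
  next
    case 3
    then obtain y where "y \<le> 3 * n" "level x = Suc (level y)" using down by auto
    then show ?thesis using 3 x by (intro bexI[of _ y]) (auto simp: level_dist_def)
  next
    case 4
    then obtain y where "y \<le> 3 * n" "level y = Suc (level x)" using up by auto
    then show ?thesis using 4 x by (intro bexI[of _ y]) (auto simp: level_dist_def)
  qed
qed (use assms in auto)

lemma level_dist_less_iff:
  assumes "level y = Suc (level x)"
  shows "level_dist w x < level_dist w y \<longleftrightarrow>
      level w < level x \<or> w = x \<or> level w = level y \<and> w \<noteq> y"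
  using assms by (auto simp: level_dist_def)

text \<open>By parity: the level distance is congruent modulo 2 to the difference of levels, also in
  the exceptional case where it is 2.\<close>

lemma level_dist_neq:
  assumes "level y = Suc (level x)"
  shows "level_dist w x \<noteq> level_dist w y"
  using assms by (auto simp: level_dist_def)

text \<open>Nearer to the lower end are the vertices up to the left cut vertex, and one middle
  vertex.  By parity all the others are nearer to the upper end.\<close>

lemma closer_ends:
  assumes "i < n" "j < 4"
  shows "closer (level_graph n) (lower_end (i, j)) (upper_end (i, j)) = 3 * i + 2"
    and "closer (level_graph n) (upper_end (i, j)) (lower_end (i, j)) = 3 * (n - i) - 1"
proof -
  define x y where "x = lower_end (i, j)" and "y = upper_end (i, j)"
  have lev: "level y = Suc (level x)"
    unfolding x_def y_def using assms(2) by (rule level_ends)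
  have le: "x \<le> 3 * n" "y \<le> 3 * n"
    using ends_le[OF assms] by (simp_all add: x_def y_def)
  \<comment> \<open>The middle vertex on the side of x: it is x itself if x is a middle vertex, and
    otherwise the middle vertex other than y, at distance 1 from x and 2 from y.\<close>
  define c where "c = (if j = 0 \<or> j = 3 then 3 * i + 2 else 3 * i + 1)"
  have nearer: "level w < level x \<or> w = x \<or> level w = level y \<and> w \<noteq> y \<longleftrightarrow> w \<le> 3 * i \<or> w = c" for w
  proof -
    have "level w = 2 * i + 2 \<longleftrightarrow> w = 3 * i + 3"
      using level_eq_even_iff[of w "i + 1"] by (simp add: add.commute)
    note lev_w = this level_less_even_iff[of w i] level_less_odd_iff[of w i] level_eq_odd_iff[of w i]
    consider "x = 3 * i" "y = 3 * i + 1" "c = 3 * i + 2" | "x = 3 * i" "y = 3 * i + 2" "c = 3 * i + 1"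
      | "x = 3 * i + 1" "y = 3 * i + 3" "c = 3 * i + 1" | "x = 3 * i + 2" "y = 3 * i + 3" "c = 3 * i + 2"
      using assms(2) unfolding x_def y_def c_def less_four_iff
      by (elim disjE) (simp_all add: lower_end_def upper_end_def)
    then show ?thesis
      by cases (simp_all only: level_simps lev_w, auto)
  qed
  have "gdist (level_graph n) w x < gdist (level_graph n) w y \<longleftrightarrow> w \<le> 3 * i \<or> w = c"
    if "w \<le> 3 * n" for w
    using that le by (simp add: gdist_level_graph level_dist_less_iff[OF lev] nearer)
  then have low: "{w \<in> verts (level_graph n). gdist (level_graph n) w x < gdist (level_graph n) w y}
      = insert c {..3 * i}"
    using assms(1) by (auto simp: c_def)
  then show "closer (level_graph n) (lower_end (i, j)) (upper_end (i, j)) = 3 * i + 2"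
    unfolding closer_def x_def[symmetric] y_def[symmetric] low by (simp add: c_def)
  have "gdist (level_graph n) w y < gdist (level_graph n) w x
      \<longleftrightarrow> \<not> gdist (level_graph n) w x < gdist (level_graph n) w y" if "w \<le> 3 * n" for w
    using level_dist_neq[OF lev, of w] that le by (simp add: gdist_level_graph; linarith)
  then have high: "{w \<in> verts (level_graph n). gdist (level_graph n) w y < gdist (level_graph n) w x}
      = {..3 * n} - {w \<in> verts (level_graph n). gdist (level_graph n) w x < gdist (level_graph n) w y}"
    by auto
  have "insert c {..3 * i} \<subseteq> {..3 * n}"
    using assms by (auto simp: c_def)
  moreover have "card (insert c {..3 * i}) = 3 * i + 2"
    by (simp add: c_def)
  ultimately have "card ({..3 * n} - insert c {..3 * i}) = 3 * n + 1 - (3 * i + 2)"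
    by (subst card_Diff_subset) auto
  then show "closer (level_graph n) (upper_end (i, j)) (lower_end (i, j)) = 3 * (n - i) - 1"
    unfolding closer_def x_def[symmetric] y_def[symmetric] high low using assms(1) by simp
qed

text \<open>The four edges of a square give equal terms; the summation index counts squares from 1.\<close>

lemma ABC_GG_para_chain:
  assumes "n \<ge> 1"
  shows "ABC_GG (para_chain n) =
    4 * (\<Sum>i=1..n. sqrt ((3 * real n - 1) / ((3 * real n - 3 * real i + 2) * (3 * real i - 1))))"
proof -
  obtain h where emb: "graph_embedding h (level_graph n)"
    and pc: "para_chain n = graph_image h (level_graph n)"
    using para_chain_level_graph[OF assms] .
  interpret graph_embedding h "level_graph n" by (rule emb)
  let ?f = "\<lambda>a b. sqrt ((real a + real b - 2) / (real a * real b))"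
  define g where "g i = sqrt ((3 * real n - 1) / ((3 * real n - 3 * real i + 2) * (3 * real i - 1)))" for i
  have val: "?f (closer (para_chain n) (h (lower_end (i, j))) (h (upper_end (i, j))))
                (closer (para_chain n) (h (upper_end (i, j))) (h (lower_end (i, j)))) = g (Suc i)"
    if "i < n" "j < 4" for i j
  proof -
    have A: "real (closer (para_chain n) (h (lower_end (i, j))) (h (upper_end (i, j)))) = 3 * real i + 2"
      and B: "real (closer (para_chain n) (h (upper_end (i, j))) (h (lower_end (i, j)))) = 3 * real n - 3 * real i - 1"
      using ends_le[OF that] closer_ends[OF that] that(1)
      by (simp_all add: pc closer_image of_nat_diff)
    show ?thesis
      unfolding A B g_def
      by (intro arg_cong[where f = sqrt] arg_cong2[where f = "(/)"]) (simp_all add: algebra_simps)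
  qed
  have "ABC_GG (para_chain n) = (\<Sum>(i, j)\<in>{..<n} \<times> {..<4::nat}. g (Suc i))"
    unfolding ABC_GG_def pc
  proof (subst edge_sum_para_chain[OF emb])
    show "?f (closer (graph_image h (level_graph n)) u v) (closer (graph_image h (level_graph n)) v u)
        = ?f (closer (graph_image h (level_graph n)) v u) (closer (graph_image h (level_graph n)) u v)" for u v
      by (simp only: add.commute mult.commute)
  qed (rule sum.cong[OF refl], use val[unfolded pc] in auto)
  also have "\<dots> = 4 * (\<Sum>i<n. g (Suc i))"
    by (simp add: sum.cartesian_product[symmetric] sum_distrib_left)
  also have "(\<Sum>i<n. g (Suc i)) = (\<Sum>i=1..n. g i)"
    by (simp add: sum.atLeast1_atMost_eq)
  finally show ?thesis by (simp add: g_def)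
qed

section \<open>Folding a palindromic sum\<close>

lemma sum_palindrome:
  fixes g :: "nat \<Rightarrow> 'a::semiring_1"
  assumes "2 * k \<le> n" and pal: "\<And>i. i \<in> {1..n} \<Longrightarrow> g (n + 1 - i) = g i"
  shows "(\<Sum>i=1..n. g i) = 2 * (\<Sum>i=1..k. g i) + (\<Sum>i\<in>{k<..n - k}. g i)"
proof -
  have "{1..n} = ({1..k} \<union> {n - k<..n}) \<union> {k<..n - k}"
    using assms(1) by auto
  then have "(\<Sum>i=1..n. g i) = (\<Sum>i=1..k. g i) + (\<Sum>i\<in>{n - k<..n}. g i) + (\<Sum>i\<in>{k<..n - k}. g i)"
    using assms(1) by (simp only:) (subst sum.union_disjoint, auto)+
  moreover have "(\<Sum>i\<in>{n - k<..n}. g i) = (\<Sum>i=1..k. g i)"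
    using assms(1) by (intro sum.reindex_bij_witness[of _ "\<lambda>i. n + 1 - i" "\<lambda>i. n + 1 - i"])
      (use pal in auto)
  ultimately show ?thesis by (simp add: mult_2)
qed

theorem theorem3p4:
  shows "(\<forall>n\<ge>1. \<forall>k\<ge>1.
      (n = 2 * k \<longrightarrow>
         ABC_GG (para_chain n) =
           8 * (\<Sum>i=1..k. sqrt ((6 * real k - 1) /
                 ((6 * real k - 3 * real i + 2) * (3 * real i - 1))))) \<and>
      (n = 2 * k + 1 \<longrightarrow>
         ABC_GG (para_chain n) =
           8 * (\<Sum>i=1..k. sqrt ((6 * real k + 2) /
                 ((6 * real k - 3 * real i + 5) * (3 * real i - 1))))
           + 4 * sqrt (6 * real k + 2) / (3 * real k + 2)))
    \<and> (\<forall>n\<ge>2. ABC (para_chain n) = 2 * real n * sqrt 2)"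
proof (intro conjI allI impI)
  fix n k :: nat assume n: "n \<ge> 1"
  define g where "g i = sqrt ((3 * real n - 1) / ((3 * real n - 3 * real i + 2) * (3 * real i - 1)))" for i
  have pal: "g (n + 1 - i) = g i" if "i \<in> {1..n}" for i
    using that by (simp add: g_def of_nat_diff algebra_simps)
  have GG: "ABC_GG (para_chain n) = 4 * (\<Sum>i=1..n. g i)"
    unfolding g_def by (rule ABC_GG_para_chain[OF n])
  {
    assume nk: "n = 2 * k"
    then have "(\<Sum>i=1..n. g i) = 2 * (\<Sum>i=1..k. g i)"
      using pal by (subst sum_palindrome[of k]) auto
    then show "ABC_GG (para_chain n) =
           8 * (\<Sum>i=1..k. sqrt ((6 * real k - 1) /
                 ((6 * real k - 3 * real i + 2) * (3 * real i - 1))))"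
      unfolding GG by (simp add: g_def nk)
  next
    assume nk: "n = 2 * k + 1"
    then have "{k<..n - k} = {k + 1}" by auto
    then have "(\<Sum>i=1..n. g i) = 2 * (\<Sum>i=1..k. g i) + g (k + 1)"
      using pal nk by (subst sum_palindrome[of k]) auto
    \<comment> \<open>In the middle square both counts are $3k+2$, so the denominator is a perfect square.\<close>
    moreover have "g (k + 1) = sqrt ((6 * real k + 2) / (3 * real k + 2)\<^sup>2)"
      by (simp add: g_def nk algebra_simps power2_eq_square)
    then have "g (k + 1) = sqrt (6 * real k + 2) / (3 * real k + 2)"
      by (simp add: real_sqrt_divide)
    moreover have "(\<Sum>i=1..k. g i) = (\<Sum>i=1..k. sqrt ((6 * real k + 2) /
                 ((6 * real k - 3 * real i + 5) * (3 * real i - 1))))"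
      by (simp add: g_def nk algebra_simps)
    ultimately show "ABC_GG (para_chain n) =
           8 * (\<Sum>i=1..k. sqrt ((6 * real k + 2) /
                 ((6 * real k - 3 * real i + 5) * (3 * real i - 1))))
           + 4 * sqrt (6 * real k + 2) / (3 * real k + 2)"
      unfolding GG by simp
  }
next
  fix n :: nat assume "n \<ge> 2"
  then show "ABC (para_chain n) = 2 * real n * sqrt 2"
    by (intro ABC_para_chain) simp
qed

end
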